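(* Let $\mathbb{L}$ be a field and let $S\in M_n(\mathbb{L})$ be a semisimple matrix. 1) $S$ is unbreakable over $\mathbb{L}$ if and only if $S=0$ (i.e. $Sp^*(S)=\emptyset$) or $Sp^*(S)$ consists of a single conjugacy class over $\mathbb{L}$. 2) If $Sp^*(S)$ consists of $l\ge 1$ conjugacy classes over $\mathbb{L}$, then there exist $l$ unbreakable (over $\mathbb{L}$) semisimple matrices $S_1,\dots,S_l\in M_n(\mathbb{L})\setminus\{0\}$ such that $S=S_1+\cdots+S_l$ and, for every $i\ne j$, $S_iS_j=0$ and $Sp^*(S_i)\cap Sp^*(S_j)=\emptyset$. 3) If $S\ne0$, the decomposition of $S$ in unbreakable semisimple matrices with the properties stated in (2) is unique up to the order of the matrices $S_i$.
   Context: A square matrix with coefficients in $\mathbb{L}$ is semisimple if it is diagonalizable over the algebraic closure $\overline{\mathbb{L}}$. For a square matrix $A$ over $\mathbb{L}$, $Sp^*(A)$ is the set of nonzero eigenvalues of $A$ in $\overline{\mathbb{L}}$. A conjugacy class over $\mathbb{L}$ is the set of all distinct roots in $\overline{\mathbb{L}}$ of a polynomial irreducible over $\mathbb{L}$; $Sp^*(A)$ is always a disjoint union of conjugacy classes over $\mathbb{L}$. A semisimple matrix $S\in M_n(\mathbb{L})$ is unbreakable over $\mathbb{L}$ if, whenever $S=A+B$ with $A,B\in M_n(\mathbb{L})$ semisimple matrices, $AB=BA=0$ and $Sp^*(A)\cap Sp^*(B)=\emptyset$, then $A=0$ or $B=0$. *)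

theory Defs
  imports
    "HOL-Library.Disjoint_Sets"
    "HOL-Combinatorics.Permutations"
    "HOL-Algebra.Algebraic_Closure_Type"
    "Jordan_Normal_Form.Char_Poly"
begin

(* The base field is the type 'a; its algebraic closure is the type 'a alg_closure,
   with embedding to_ac.  M_n is carrier_mat n n. *)

(* similar_mat forces A to be square. *)
definition semisimple :: "'a::field mat \<Rightarrow> bool" where
  "semisimple A \<longleftrightarrow> (\<exists>D. diagonal_mat D \<and> similar_mat (map_mat to_ac A) D)"

definition nonzero_spectrum :: "'a::field mat \<Rightarrow> 'a alg_closure set" where
  "nonzero_spectrum A = {x. eigenvalue (map_mat to_ac A) x \<and> x \<noteq> 0}"

definition conjugacy_class :: "'a::field alg_closure set \<Rightarrow> bool" where
  "conjugacy_class C \<longleftrightarrow>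
     (\<exists>p::'a poly. Factorial_Ring.irreducible p \<and> C = {x. poly (map_poly to_ac p) x = 0})"

definition consists_of_classes :: "'a::field alg_closure set \<Rightarrow> nat \<Rightarrow> bool" where
  "consists_of_classes E l \<longleftrightarrow>
     (\<exists>\<C>. finite \<C> \<and> card \<C> = l \<and> (\<forall>C\<in>\<C>. conjugacy_class C) \<and> disjoint \<C> \<and> \<Union>\<C> = E)"

definition unbreakable :: "'a::field mat \<Rightarrow> bool" where
  "unbreakable S \<longleftrightarrow> semisimple S \<and>
     (let n = dim_row S in
       \<forall>A\<in>carrier_mat n n. \<forall>B\<in>carrier_mat n n.
         semisimple A \<and> semisimple B \<and> S = A + B \<and>
         A * B = 0\<^sub>m n n \<and> B * A = 0\<^sub>m n n \<and>
         nonzero_spectrum A \<inter> nonzero_spectrum B = {} \<longrightarrow>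
         A = 0\<^sub>m n n \<or> B = 0\<^sub>m n n)"

(* The summands are indexed by 0, ..., l - 1.  Matrices of all sizes share one type, which
   is not an additive monoid, so the sum is taken in the additive group of
   n by n matrices (module_mat). *)
definition unbreakable_decomposition ::
    "nat \<Rightarrow> 'a::field mat \<Rightarrow> nat \<Rightarrow> (nat \<Rightarrow> 'a mat) \<Rightarrow> bool" where
  "unbreakable_decomposition n S l T \<longleftrightarrow>
     (\<forall>i<l. T i \<in> carrier_mat n n \<and> T i \<noteq> 0\<^sub>m n n \<and> semisimple (T i) \<and> unbreakable (T i)) \<and>
     S = finsum (module_mat TYPE('a) n n) T {..<l} \<and>
     (\<forall>i<l. \<forall>j<l. i \<noteq> j \<longrightarrow>
        T i * T j = 0\<^sub>m n n \<and> nonzero_spectrum (T i) \<inter> nonzero_spectrum (T j) = {})"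

end

theory Submission
  imports Defs
begin

text \<open>
  Over the algebraic closure, \<open>S\<close> is \<open>P D P\<^sup>-\<^sup>1\<close> with \<open>D\<close> diagonal, and a polynomial \<open>f\<close> over the base
  field turns it into \<open>P f(D) P\<^sup>-\<^sup>1\<close>, which is again a matrix over the base field.  So everything
  depends on which functions on the spectrum are values of such polynomials.  If \<open>C\<close> is the
  conjugacy class of the irreducible polynomial \<open>p\<close>, remove all factors \<open>p\<close> from the characteristic
  polynomial of \<open>S\<close>: the remaining factor is coprime to \<open>p\<close>, and the Bezout identity yields a
  polynomial that is 1 on \<open>C\<close> and 0 on all other eigenvalues (\<open>separating_polynomial\<close>).
  Multiplied by the indeterminate and evaluated at \<open>S\<close>, it gives the part of \<open>S\<close> that belongs to \<open>C\<close>
  (\<open>class_component\<close>).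

  Existence: the parts of \<open>S\<close> for the different classes are semisimple, annihilate each
  other, and add up to \<open>S\<close>.

  Unbreakability: if a nonzero \<open>S\<close> is unbreakable, split off the part of a single class; what
  remains has to vanish, so there is only one class.  Conversely, \<open>A B = B A = 0\<close> makes the nonzero
  spectrum of \<open>A + B\<close> the union of those of \<open>A\<close> and \<open>B\<close> (\<open>nonzero_spectrum_add\<close>).  Both are closed
  under conjugacy (\<open>nonzero_spectrum_closed\<close>), so if their disjoint union is a single class, one of
  them is empty, and a semisimple matrix without nonzero eigenvalues is 0.

  Uniqueness: let \<open>v\<close> be an eigenvector of \<open>S\<close> for \<open>x\<close>.  A summand \<open>T i\<close> of a decomposition
  kills \<open>v\<close> unless \<open>x\<close> lies in its nonzero spectrum, and otherwise, all other summands being killed,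
  it maps \<open>v\<close> to \<open>x v\<close>.  As the eigenvectors of \<open>S\<close> span, \<open>T i\<close> is determined by \<open>S\<close> and the
  conjugacy class that is its spectrum (\<open>decomposition_summand_spec\<close>); these classes are exactly
  the ones that make up the spectrum of \<open>S\<close> (\<open>decomposition_classes\<close>).
\<close>

section \<open>Conjugacy classes and separating polynomials\<close>

interpretation to_ac: field_hom "to_ac :: 'a::field \<Rightarrow> 'a alg_closure"
  by unfold_locales auto

interpretation map_poly_to_ac: map_poly_comm_ring_hom "to_ac :: 'a::field \<Rightarrow> 'a alg_closure" ..

abbreviation poly_ac :: "'a::field poly \<Rightarrow> 'a alg_closure \<Rightarrow> 'a alg_closure" where
  "poly_ac p x \<equiv> poly (map_poly to_ac p) x"

text \<open>
  An element \<open>r\<close> of least degree in the ideal generated by \<open>p\<close> and \<open>q\<close> divides both of them by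
  division with remainder; as \<open>p\<close> is irreducible and does not divide \<open>q\<close>, it is a unit.
\<close>

lemma bezout_irreducible:
  fixes p q :: "'a::field poly"
  assumes irr: "Factorial_Ring.irreducible p" and ndvd: "\<not> p dvd q"
  obtains u v where "u * p + v * q = 1"
proof -
  define I where "I = {r. r \<noteq> 0 \<and> (\<exists>u v. r = u * p + v * q)}"
  have "p = 1 * p + 0 * q" by simp
  with irr have "p \<in> I" unfolding I_def Factorial_Ring.irreducible_def by blast
  then obtain r where r: "r \<in> I" and min: "\<And>s. s \<in> I \<Longrightarrow> degree r \<le> degree s"
    using arg_min_nat_lemma[of "\<lambda>r. r \<in> I" p degree] by blast
  from r obtain u v where r0: "r \<noteq> 0" and ruv: "r = u * p + v * q"
    unfolding I_def by blast
  have dvd: "r dvd x * p + y * q" for x y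
  proof (rule ccontr)
    assume ndvd: "\<not> r dvd x * p + y * q"
    define t where "t = (x * p + y * q) div r"
    have "(x * p + y * q) mod r = (x * p + y * q) - t * r"
      by (simp add: minus_div_mult_eq_mod t_def)
    also have "\<dots> = (x - t * u) * p + (y - t * v) * q"
      unfolding ruv by (simp add: algebra_simps)
    finally have "(x * p + y * q) mod r \<in> I"
      using ndvd unfolding I_def by (auto simp: dvd_eq_mod_eq_0)
    with degree_mod_less_degree[OF r0 ndvd] min show False by fastforce
  qed
  have "r dvd p" "r dvd q" using dvd[of 1 0] dvd[of 0 1] by simp_all
  then have "is_unit r"
    using irr ndvd unfolding irreducible_altdef by (metis dvd_trans)
  then obtain w where "1 = r * w" by blast
  with ruv have "(w * u) * p + (w * v) * q = 1" by (simp add: algebra_simps)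
  then show thesis by (rule that)
qed

text \<open>
  Otherwise a Bezout identity, evaluated at the common root, would read \<open>0 = 1\<close>.
\<close>

lemma irreducible_dvd_if_common_root:
  assumes "Factorial_Ring.irreducible p" "poly_ac p x = 0" "poly_ac q x = 0"
  shows "p dvd q"
proof (rule ccontr)
  assume "\<not> p dvd q"
  with assms(1) obtain u v where "u * p + v * q = 1" by (rule bezout_irreducible)
  then have "poly_ac (u * p + v * q) x = poly_ac 1 x" by simp
  with assms(2,3) show False by (simp add: hom_distribs)
qed

lemma poly_ac_dvd:
  assumes "p dvd q" "poly_ac p x = 0"
  shows "poly_ac q x = 0"
  using assms by (auto elim!: dvdE simp: hom_distribs)

text \<open>
  Conjugate elements cannot be told apart by polynomials over the base field.
\<close>

lemma conjugacy_class_subset_roots: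
  assumes "conjugacy_class C" "x \<in> C" "poly_ac q x = 0" "y \<in> C"
  shows "poly_ac q y = 0"
  using assms irreducible_dvd_if_common_root poly_ac_dvd unfolding conjugacy_class_def by blast

lemma conjugacy_class_unique:
  assumes "conjugacy_class C" "conjugacy_class D" "x \<in> C" "x \<in> D"
  shows "C = D"
  using conjugacy_class_subset_roots[OF assms(1,3)] conjugacy_class_subset_roots[OF assms(2,4)]
    assms unfolding conjugacy_class_def by blast

lemma conjugacy_class_nonempty:
  assumes "conjugacy_class C"
  shows "C \<noteq> {}"
proof -
  from assms obtain p :: "'a poly" where irr: "Factorial_Ring.irreducible p"
    and C: "C = {x. poly_ac p x = 0}" unfolding conjugacy_class_def by blast
  from irr have "degree p > 0"
    using is_unit_iff_degree[of p] by (auto simp: Factorial_Ring.irreducible_def)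
  then have "degree (map_poly to_ac p) > 0" by simp
  from alg_closed_imp_poly_has_root[OF this] show ?thesis using C by blast
qed

text \<open>
  The class of \<open>x\<close> is the root set of its minimal polynomial.
\<close>

lemma conjugacy_class_ex:
  fixes x :: "'a::field alg_closure"
  obtains C where "conjugacy_class C" "x \<in> C"
proof -
  define I :: "'a poly \<Rightarrow> bool" where "I = (\<lambda>p. p \<noteq> 0 \<and> poly_ac p x = 0)"
  obtain p0 where "I p0" unfolding I_def using alg_closure_algebraic by blast
  then obtain p where p: "I p" and min: "\<And>q. I q \<Longrightarrow> degree p \<le> degree q"
    using arg_min_nat_lemma[of I p0 degree] by blast
  have "Factorial_Ring.irreducible p"
  proof (rule Factorial_Ring.irreducibleI)
    show p0: "p \<noteq> 0" using p by (simp add: I_def)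
    show "\<not> is_unit p"
    proof
      assume "is_unit p"
      then have "poly_ac 1 x = 0" using p poly_ac_dvd unfolding I_def by blast
      then show False by simp
    qed
    fix a b assume ab: "p = a * b"
    with p0 have nz: "a \<noteq> 0" "b \<noteq> 0" by auto
    have "poly_ac a x = 0 \<or> poly_ac b x = 0"
      using p ab by (simp add: I_def hom_distribs)
    then have "degree p \<le> degree a \<or> degree p \<le> degree b"
      using min nz unfolding I_def by blast
    then show "is_unit a \<or> is_unit b"
      using nz by (auto simp: ab degree_mult_eq is_unit_iff_degree)
  qed
  then show thesis using p that[of "{x. poly_ac p x = 0}"] unfolding I_def conjugacy_class_def by blast
qed

lemma conjugacy_class_zero:
  assumes "conjugacy_class C" "0 \<in> C"
  shows "C = {0}"
  using conjugacy_class_subset_roots[OF assms, of "[:0, 1:]"] assms(2)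
  by (auto simp: hom_distribs)

text \<open>
  Dividing out \<open>p\<close> as often as possible loses roots of \<open>p\<close> only.
\<close>

lemma remove_irreducible_factor:
  fixes p q :: "'a::field poly"
  assumes irr: "Factorial_Ring.irreducible p" and "q \<noteq> 0"
  shows "\<exists>r. \<not> p dvd r \<and> (\<forall>x. poly_ac q x = 0 \<and> poly_ac p x \<noteq> 0 \<longrightarrow> poly_ac r x = 0)"
  using \<open>q \<noteq> 0\<close>
proof (induction "degree q" arbitrary: q rule: less_induct)
  case less
  show ?case
  proof (cases "p dvd q")
    case True
    then obtain q' where q': "q = p * q'" by blast
    with less.prems have nz: "p \<noteq> 0" "q' \<noteq> 0" by auto
    have "degree p > 0"
      using irr is_unit_iff_degree[OF nz(1)] by (auto simp: Factorial_Ring.irreducible_def)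
    then have "degree q' < degree q" using nz by (simp add: q' degree_mult_eq)
    from less.hyps[OF this nz(2)] show ?thesis by (auto simp: q' hom_distribs)
  qed auto
qed

text \<open>
  With \<open>C\<close> the root set of \<open>p\<close> and \<open>r\<close> what is left of \<open>q\<close> without its factors \<open>p\<close>, the Bezout
  identity \<open>u p + v r = 1\<close> provides \<open>e = v r\<close>: on \<open>C\<close> the first summand vanishes, and on the other
  roots of \<open>q\<close> the factor \<open>r\<close> does.
\<close>

lemma separating_polynomial:
  fixes q :: "'a::field poly"
  assumes "conjugacy_class C" "q \<noteq> 0"
  obtains e where "\<And>x. x \<in> C \<Longrightarrow> poly_ac e x = 1"
    "\<And>x. poly_ac q x = 0 \<Longrightarrow> x \<notin> C \<Longrightarrow> poly_ac e x = 0"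
proof -
  from assms(1) obtain p :: "'a poly" where irr: "Factorial_Ring.irreducible p"
    and C: "C = {x. poly_ac p x = 0}" unfolding conjugacy_class_def by blast
  from remove_irreducible_factor[OF irr assms(2)] obtain r where ndvd: "\<not> p dvd r"
    and r: "\<And>x. poly_ac q x = 0 \<Longrightarrow> poly_ac p x \<noteq> 0 \<Longrightarrow> poly_ac r x = 0" by blast
  from irr ndvd obtain u v where uv: "u * p + v * r = 1" by (rule bezout_irreducible)
  have "poly_ac (v * r) x = 1" if "x \<in> C" for x
    using arg_cong[OF uv, of "\<lambda>p. poly_ac p x"] that by (simp add: C hom_distribs)
  moreover have "poly_ac (v * r) x = 0" if "poly_ac q x = 0" "x \<notin> C" for x
    using r that by (simp add: C hom_distribs)
  ultimately show thesis by (rule that)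
qed

section \<open>Matrices with a common eigenbasis\<close>

text \<open>
  The columns of \<open>P\<close> are a basis of \<open>n\<close>-space, and \<open>spec d\<close> is the matrix that has them as
  eigenvectors with eigenvalues \<open>d 0, ..., d (n - 1)\<close>.  Sums and products of such matrices are
  computed entrywise on the eigenvalues, which turns matrix identities into identities of scalars.
\<close>

locale eigenbasis =
  fixes n :: nat and P Q :: "'b::field mat"
  assumes P [simp]: "P \<in> carrier_mat n n" and Q [simp]: "Q \<in> carrier_mat n n"
    and PQ: "P * Q = 1\<^sub>m n" and QP: "Q * P = 1\<^sub>m n"
begin

lemma mult_carrier_square [simp]:
  "A \<in> carrier_mat n n \<Longrightarrow> B \<in> carrier_mat n n \<Longrightarrow> A * B \<in> carrier_mat n n"
  by (rule mult_carrier_mat)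

lemmas assoc_square = assoc_mult_mat[of _ n n _ n _ n]

definition spec :: "(nat \<Rightarrow> 'b) \<Rightarrow> 'b mat" where
  "spec d = P * mat_diag n d * Q"

lemma spec_carrier [simp]: "spec d \<in> carrier_mat n n"
  unfolding spec_def by (intro mult_carrier_mat[of _ n n] P Q mat_diag_dim)

lemma spec_cong: "(\<And>i. i < n \<Longrightarrow> d i = e i) \<Longrightarrow> spec d = spec e"
  unfolding spec_def mat_diag_def by (intro arg_cong2[of _ _ _ _ "(*)"] refl eq_matI) auto

lemma spec_add: "spec d + spec e = spec (\<lambda>i. d i + e i)"
proof -
  have "mat_diag n (\<lambda>i. d i + e i) = mat_diag n d + mat_diag n e"
    unfolding mat_diag_def by (rule eq_matI) auto
  then show ?thesis
    unfolding spec_def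
    by (simp add: mult_add_distrib_mat[of _ n n _ n] add_mult_distrib_mat[of _ n n _ _ n])
qed

lemma spec_diff: "spec d - spec e = spec (\<lambda>i. d i - e i)"
proof -
  have "mat_diag n (\<lambda>i. d i - e i) = mat_diag n d - mat_diag n e"
    unfolding mat_diag_def by (rule eq_matI) auto
  then show ?thesis
    unfolding spec_def
    by (simp add: mult_minus_distrib_mat[of _ n n _ n] minus_mult_distrib_mat[of _ n n _ _ n])
qed

lemma spec_mult_P: "spec d * P = P * mat_diag n d"
  unfolding spec_def by (simp add: QP assoc_square right_mult_one_mat[of _ n n])

lemma spec_mult: "spec d * spec e = spec (\<lambda>i. d i * e i)"
proof -
  have "spec d * spec e = (spec d * P) * mat_diag n e * Q"
    unfolding spec_def[of e] by (simp add: assoc_square)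
  also have "\<dots> = P * (mat_diag n d * mat_diag n e) * Q"
    unfolding spec_mult_P by (simp add: assoc_square del: mat_diag_diag)
  finally show ?thesis by (simp add: spec_def)
qed

lemma spec_const: "spec (\<lambda>_. c) = c \<cdot>\<^sub>m 1\<^sub>m n"
proof -
  have "mat_diag n (\<lambda>_. c) = c \<cdot>\<^sub>m 1\<^sub>m n" unfolding mat_diag_def by (rule eq_matI) auto
  then show ?thesis
    unfolding spec_def by (simp add: mult_smult_distrib[of _ n n _ n] mult_smult_assoc_mat[of _ n n _ n] right_mult_one_mat[of _ n n] PQ)
qed

lemma spec_0: "spec (\<lambda>_. 0) = 0\<^sub>m n n"
  unfolding spec_const by (rule eq_matI) auto

lemma spec_similar: "similar_mat (spec d) (mat_diag n d)"
  by (rule similar_matI[of _ _ P Q n]) (auto simp: PQ QP spec_def)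

lemma spec_eigenvalue: "eigenvalue (spec d) x \<longleftrightarrow> (\<exists>i<n. d i = x)"
proof -
  have "char_poly (spec d) = (\<Prod>a\<leftarrow>diag_mat (mat_diag n d). [:- a, 1:])"
    unfolding char_poly_similar[OF spec_similar]
    by (rule char_poly_upper_triangular[OF mat_diag_dim])
       (auto simp: mat_diag_def intro!: upper_triangularI)
  also have "diag_mat (mat_diag n d) = map d [0..<n]"
    unfolding diag_mat_def mat_diag_def by auto
  finally show ?thesis
    unfolding eigenvalue_root_char_poly[OF spec_carrier]
    by (auto simp: poly_prod_list prod_list_zero_iff)
qed

lemma spec_mult_col:
  assumes "k < n"
  shows "spec d *\<^sub>v col P k = d k \<cdot>\<^sub>v col P k"
proof -
  have "spec d *\<^sub>v col P k = col (spec d * P) k"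
    using assms by (subst col_mult2[of _ n n _ n]) auto
  also have "\<dots> = d k \<cdot>\<^sub>v col P k"
    unfolding spec_mult_P mat_diag_mult_right[OF P]
    using assms carrier_matD[OF P] by (intro eq_vecI) (auto simp: mult.commute)
  finally show ?thesis .
qed

lemma eq_specI:
  assumes M: "M \<in> carrier_mat n n"
    and cols: "\<And>k. k < n \<Longrightarrow> M *\<^sub>v col P k = d k \<cdot>\<^sub>v col P k"
  shows "M = spec d"
proof -
  have "M * P = spec d * P"
  proof (rule eq_matI)
    fix i j assume "i < dim_row (spec d * P)" "j < dim_col (spec d * P)"
    then have i: "i < n" and j: "j < n" by (auto simp: carrier_matD[OF spec_carrier] carrier_matD[OF P])
    have "col (M * P) j = col (spec d * P) j"
      using cols[OF j] spec_mult_col[OF j] M j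
      by (simp add: col_mult2[OF M P] col_mult2[OF spec_carrier P])
    then have "col (M * P) j $ i = col (spec d * P) j $ i" by simp
    then show "(M * P) $$ (i, j) = (spec d * P) $$ (i, j)"
      using i j M carrier_matD[OF spec_carrier] carrier_matD[OF P] by simp
  qed (use M carrier_matD[OF spec_carrier] in auto)
  then have "(M * P) * Q = (spec d * P) * Q" by simp
  then show ?thesis using M by (simp add: assoc_square PQ right_mult_one_mat[of _ n n])
qed

end

section \<open>Semisimple matrices as spectral matrices over the algebraic closure\<close>

lemma semisimple_imp_spec:
  assumes A: "A \<in> carrier_mat n n" and ss: "semisimple A"
  obtains P Q d where "eigenbasis n P Q" "map_mat to_ac A = eigenbasis.spec n P Q d"
proof -
  from ss obtain D where diag: "diagonal_mat D" and sim: "similar_mat (map_mat to_ac A) D"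
    unfolding semisimple_def by blast
  from sim obtain P Q where wit: "similar_mat_wit (map_mat to_ac A) D P Q"
    unfolding similar_mat_def by blast
  have "map_mat to_ac A \<in> carrier_mat n n" using A by simp
  note w = similar_mat_witD2[OF this wit]
  interpret eigenbasis n P Q using w by unfold_locales auto
  have "D = mat_diag n (\<lambda>i. D $$ (i, i))"
    using diag w(5) unfolding diagonal_mat_def mat_diag_def by (intro eq_matI) auto
  then have "map_mat to_ac A = spec (\<lambda>i. D $$ (i, i))"
    using w(3) unfolding spec_def by simp
  then show thesis using that eigenbasis_axioms by blast
qed

lemma semisimple_if_spec:
  assumes "eigenbasis n P Q" "map_mat to_ac A = eigenbasis.spec n P Q d"
  shows "semisimple A"
proof -
  interpret eigenbasis n P Q by fact
  have "diagonal_mat (mat_diag n d)" unfolding diagonal_mat_def mat_diag_def by auto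
  then show ?thesis using spec_similar[of d] unfolding semisimple_def assms(2) by blast
qed

lemma nonzero_spectrum_spec:
  assumes "eigenbasis n P Q" "map_mat to_ac A = eigenbasis.spec n P Q d"
  shows "nonzero_spectrum A = d ` {..<n} - {0}"
proof -
  interpret eigenbasis n P Q by fact
  show ?thesis unfolding nonzero_spectrum_def assms(2) spec_eigenvalue by auto
qed

lemma map_to_ac_0 [simp]: "map_mat to_ac (0\<^sub>m n m) = 0\<^sub>m n m"
  by (rule eq_matI) auto

lemma semisimple_eq_0_iff:
  assumes A: "A \<in> carrier_mat n n" and ss: "semisimple A"
  shows "A = 0\<^sub>m n n \<longleftrightarrow> nonzero_spectrum A = {}"
proof -
  from semisimple_imp_spec[OF A ss] obtain P Q d
    where eb: "eigenbasis n P Q" and Ad: "map_mat to_ac A = eigenbasis.spec n P Q d" .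
  interpret eigenbasis n P Q by fact
  show ?thesis
  proof
    assume "nonzero_spectrum A = {}"
    then have "d i = 0" if "i < n" for i
      using that unfolding nonzero_spectrum_spec[OF eb Ad] by auto
    then have "map_mat to_ac A = map_mat to_ac (0\<^sub>m n n)"
      unfolding Ad map_to_ac_0 spec_0[symmetric] by (rule spec_cong)
    then show "A = 0\<^sub>m n n" by (rule to_ac.mat_hom_inj)
  next
    assume "A = 0\<^sub>m n n"
    then have "map_mat to_ac A = spec (\<lambda>_. 0)" by (simp add: spec_0)
    from nonzero_spectrum_spec[OF eb this] show "nonzero_spectrum A = {}" by auto
  qed
qed

lemma map_to_ac_add:
  assumes "A \<in> carrier_mat n m" "B \<in> carrier_mat n m"
  shows "map_mat to_ac (A + B) = map_mat to_ac A + map_mat to_ac B"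
  using assms by (intro eq_matI) auto

text \<open>
  \<open>M\<close> is \<open>f(A)\<close>, obtained by Horner's scheme.  The point is that \<open>M\<close> has entries in the base field
  although the diagonalization of \<open>A\<close> lives over the algebraic closure.
\<close>

lemma polynomial_of_matrix:
  fixes A :: "'a::field mat" and f :: "'a poly"
  assumes eb: "eigenbasis n P Q" and A: "A \<in> carrier_mat n n"
    and Ad: "map_mat to_ac A = eigenbasis.spec n P Q d"
  shows "\<exists>M\<in>carrier_mat n n. map_mat to_ac M = eigenbasis.spec n P Q (\<lambda>i. poly_ac f (d i))"
proof (induction f)
  interpret eigenbasis n P Q by fact
  case 0
  then show ?case by (intro bexI[of _ "0\<^sub>m n n"]) (auto simp: spec_0)
next
  interpret eigenbasis n P Q by fact
  case (pCons a f)
  then obtain M where M: "M \<in> carrier_mat n n"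
    and Mf: "map_mat to_ac M = spec (\<lambda>i. poly_ac f (d i))" by blast
  have ev: "poly_ac (pCons a f) x = to_ac a + x * poly_ac f x" for x
    by (cases "f = 0 \<and> a = 0") (auto simp: map_poly_pCons)
  have "map_mat to_ac (a \<cdot>\<^sub>m 1\<^sub>m n) = spec (\<lambda>_. to_ac a)"
    unfolding spec_const by (rule eq_matI) auto
  then have "map_mat to_ac (a \<cdot>\<^sub>m 1\<^sub>m n + A * M) = spec (\<lambda>i. poly_ac (pCons a f) (d i))"
    using A M by (simp add: map_to_ac_add[of _ n n] to_ac.mat_hom_mult[of _ n n _ n] Mf Ad
        spec_add spec_mult ev)
  then show ?case using A M by (intro bexI[of _ "a \<cdot>\<^sub>m 1\<^sub>m n + A * M"]) auto
qed

lemma poly_char_poly_iff_eigenvalue: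
  assumes "A \<in> carrier_mat n n"
  shows "poly_ac (char_poly A) x = 0 \<longleftrightarrow> eigenvalue (map_mat to_ac A) x"
  using assms eigenvalue_root_char_poly[of "map_mat to_ac A" n x]
  by (simp add: to_ac.char_poly_hom[OF assms])

text \<open>
  Take \<open>M = A e(A)\<close>, where \<open>e\<close> is 1 on \<open>C\<close> and 0 on the other roots of the characteristic polynomial.
\<close>

lemma class_component:
  fixes A :: "'a::field mat"
  assumes eb: "eigenbasis n P Q" and A: "A \<in> carrier_mat n n"
    and Ad: "map_mat to_ac A = eigenbasis.spec n P Q d" and C: "conjugacy_class C"
  shows "\<exists>M\<in>carrier_mat n n. map_mat to_ac M = eigenbasis.spec n P Q (\<lambda>i. if d i \<in> C then d i else 0)"
proof -
  interpret eigenbasis n P Q by fact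
  have "char_poly A \<noteq> 0" using degree_monic_char_poly[OF A] by auto
  from separating_polynomial[OF C this] obtain e
    where 1: "\<And>x. x \<in> C \<Longrightarrow> poly_ac e x = 1"
      and 0: "\<And>x. poly_ac (char_poly A) x = 0 \<Longrightarrow> x \<notin> C \<Longrightarrow> poly_ac e x = 0" by blast
  have "poly_ac ([:0, 1:] * e) (d i) = (if d i \<in> C then d i else 0)" if "i < n" for i
    using that 1 0[unfolded poly_char_poly_iff_eigenvalue[OF A] Ad spec_eigenvalue]
    by (auto simp: hom_distribs)
  then have "spec (\<lambda>i. poly_ac ([:0, 1:] * e) (d i)) = spec (\<lambda>i. if d i \<in> C then d i else 0)"
    by (rule spec_cong)
  then show ?thesis using polynomial_of_matrix[OF eb A Ad, of "[:0, 1:] * e"] by simp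
qed

text \<open>
  The eigenvalues of \<open>A\<close> are the roots of a polynomial over the base field.
\<close>

lemma nonzero_spectrum_closed:
  assumes A: "A \<in> carrier_mat n n" and C: "conjugacy_class C" and x: "x \<in> C" "x \<in> nonzero_spectrum A"
  shows "C \<subseteq> nonzero_spectrum A"
proof
  fix y assume "y \<in> C"
  then have "poly_ac (char_poly A) y = 0"
    using conjugacy_class_subset_roots[OF C] x poly_char_poly_iff_eigenvalue[OF A]
    unfolding nonzero_spectrum_def by blast
  moreover have "y \<noteq> 0"
    using conjugacy_class_zero[OF C] x \<open>y \<in> C\<close> unfolding nonzero_spectrum_def by auto
  ultimately show "y \<in> nonzero_spectrum A"
    using poly_char_poly_iff_eigenvalue[OF A] unfolding nonzero_spectrum_def by blast
qed

section \<open>Sums of matrices with vanishing products\<close>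

lemma eigenvalue_iff_vec:
  assumes "A \<in> carrier_mat n n"
  shows "eigenvalue A x \<longleftrightarrow> (\<exists>v\<in>carrier_vec n. v \<noteq> 0\<^sub>v n \<and> A *\<^sub>v v = x \<cdot>\<^sub>v v)"
  using assms unfolding eigenvalue_def eigenvector_def by auto

lemma zero_mat_mult_vec [simp]:
  fixes v :: "'b::semiring_1 vec"
  assumes "v \<in> carrier_vec n"
  shows "0\<^sub>m m n *\<^sub>v v = 0\<^sub>v m"
  using assms by (intro eq_vecI) auto

lemma smult_vec_eq_0D:
  fixes v :: "'b::field vec"
  assumes "x \<cdot>\<^sub>v v = 0\<^sub>v n" "x \<noteq> 0"
  shows "v = 0\<^sub>v n"
proof -
  have "inverse x \<cdot>\<^sub>v (x \<cdot>\<^sub>v v) = 0\<^sub>v n" using assms(1) by (auto intro!: eq_vecI)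
  then show ?thesis using assms(2) by (simp add: smult_smult_assoc)
qed

text \<open>
  Indeed \<open>x B v = B A v = 0\<close>.
\<close>

lemma eigenvector_summand:
  fixes A B :: "'b::field mat"
  assumes A: "A \<in> carrier_mat n n" and B: "B \<in> carrier_mat n n"
    and BA: "B * A = 0\<^sub>m n n"
    and x: "x \<noteq> 0" and v: "v \<in> carrier_vec n" and Av: "A *\<^sub>v v = x \<cdot>\<^sub>v v"
  shows "B *\<^sub>v v = 0\<^sub>v n"
proof -
  have "x \<cdot>\<^sub>v (B *\<^sub>v v) = B *\<^sub>v (A *\<^sub>v v)"
    unfolding Av using B v by (simp add: mult_mat_vec)
  also have "\<dots> = (B * A) *\<^sub>v v"
    using A B v by (simp add: assoc_mult_mat_vec[of _ n n _ n])
  also have "\<dots> = 0\<^sub>v n" using v by (simp add: BA)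
  finally show ?thesis using x by (rule smult_vec_eq_0D)
qed

text \<open>
  An eigenvector of \<open>A\<close> for \<open>x\<close> is killed by \<open>B\<close> and hence is one of \<open>A + B\<close>; the same holds with
  \<open>A\<close> and \<open>B\<close> exchanged.  Conversely, if \<open>v\<close> is an eigenvector of \<open>A + B\<close>, then
  \<open>A (A v) = A (A + B) v = x A v\<close> and likewise \<open>B (B v) = x B v\<close>, where \<open>A v\<close> and \<open>B v\<close> cannot both
  vanish.
\<close>

lemma eigenvalue_add:
  fixes A B :: "'b::field mat"
  assumes A: "A \<in> carrier_mat n n" and B: "B \<in> carrier_mat n n"
    and AB: "A * B = 0\<^sub>m n n" and BA: "B * A = 0\<^sub>m n n" and x: "x \<noteq> 0"
  shows "eigenvalue (A + B) x \<longleftrightarrow> eigenvalue A x \<or> eigenvalue B x"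
proof
  have S: "A + B \<in> carrier_mat n n" using A B by simp
  have up: "eigenvalue (A + B) x"
    if ev: "eigenvalue A x" and A: "A \<in> carrier_mat n n" and B: "B \<in> carrier_mat n n"
      and BA: "B * A = 0\<^sub>m n n" for A B :: "'b mat"
  proof -
    from ev obtain v where v: "v \<in> carrier_vec n" "v \<noteq> 0\<^sub>v n" and Av: "A *\<^sub>v v = x \<cdot>\<^sub>v v"
      unfolding eigenvalue_iff_vec[OF A] by blast
    from eigenvector_summand[OF A B BA x v(1) Av] have "(A + B) *\<^sub>v v = x \<cdot>\<^sub>v v"
      using A B v Av by (simp add: add_mult_distrib_mat_vec[of _ n n])
    with v show ?thesis unfolding eigenvalue_iff_vec[OF add_carrier_mat[OF B]] by blast
  qed
  show "eigenvalue (A + B) x" if "eigenvalue A x \<or> eigenvalue B x"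
    using that up[OF _ A B BA] up[OF _ B A AB] comm_add_mat[OF A B] by auto
  assume "eigenvalue (A + B) x"
  then obtain v where v: "v \<in> carrier_vec n" "v \<noteq> 0\<^sub>v n" and Sv: "(A + B) *\<^sub>v v = x \<cdot>\<^sub>v v"
    unfolding eigenvalue_iff_vec[OF S] by blast
  have step: "A *\<^sub>v (A *\<^sub>v v) = x \<cdot>\<^sub>v (A *\<^sub>v v)"
    if "A \<in> carrier_mat n n" "B \<in> carrier_mat n n" "A * B = 0\<^sub>m n n" "(A + B) *\<^sub>v v = x \<cdot>\<^sub>v v"
    for A B :: "'b mat"
  proof -
    have "x \<cdot>\<^sub>v (A *\<^sub>v v) = A *\<^sub>v ((A + B) *\<^sub>v v)"
      unfolding that(4) using that v by (simp add: mult_mat_vec)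
    also have "\<dots> = (A * A) *\<^sub>v v + (A * B) *\<^sub>v v"
      using that(1,2) v by (simp add: assoc_mult_mat_vec[of _ n n _ n] add_mult_distrib_mat_vec[of _ n n]
          mult_add_distrib_mat_vec[of _ n n])
    finally show ?thesis using that v by (simp add: assoc_mult_mat_vec[of _ n n _ n])
  qed
  have "A *\<^sub>v v \<noteq> 0\<^sub>v n \<or> B *\<^sub>v v \<noteq> 0\<^sub>v n"
  proof (rule ccontr)
    assume "\<not> ?thesis"
    then have "x \<cdot>\<^sub>v v = 0\<^sub>v n"
      using Sv A B v by (simp add: add_mult_distrib_mat_vec[of _ n n])
    from smult_vec_eq_0D[OF this x] v show False by simp
  qed
  then show "eigenvalue A x \<or> eigenvalue B x"
    using step[OF A B AB Sv] step[OF B A BA Sv[unfolded comm_add_mat[OF A B]]]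
      mult_mat_vec_carrier[OF A v(1)] mult_mat_vec_carrier[OF B v(1)]
    unfolding eigenvalue_iff_vec[OF A] eigenvalue_iff_vec[OF B] by blast
qed

lemma nonzero_spectrum_add:
  fixes A B :: "'a::field mat"
  assumes A: "A \<in> carrier_mat n n" and B: "B \<in> carrier_mat n n"
    and AB: "A * B = 0\<^sub>m n n" and BA: "B * A = 0\<^sub>m n n"
  shows "nonzero_spectrum (A + B) = nonzero_spectrum A \<union> nonzero_spectrum B"
proof -
  have "map_mat to_ac A * map_mat to_ac B = 0\<^sub>m n n" "map_mat to_ac B * map_mat to_ac A = 0\<^sub>m n n"
    using AB BA by (simp_all flip: to_ac.mat_hom_mult[OF A B] to_ac.mat_hom_mult[OF B A])
  then show ?thesis
    using eigenvalue_add[of "map_mat to_ac A" n "map_mat to_ac B"] A B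
    unfolding nonzero_spectrum_def map_to_ac_add[OF A B] by auto
qed

section \<open>Unbreakable matrices\<close>

lemma unbreakable_iff:
  fixes S :: "'a::field mat"
  assumes S: "S \<in> carrier_mat n n" and ss: "semisimple S"
  shows "unbreakable S \<longleftrightarrow> S = 0\<^sub>m n n \<or> conjugacy_class (nonzero_spectrum S)"
proof
  assume unb: "unbreakable S"
  show "S = 0\<^sub>m n n \<or> conjugacy_class (nonzero_spectrum S)"
  proof (cases "S = 0\<^sub>m n n")
    case False
    then obtain x where x: "x \<in> nonzero_spectrum S"
      using semisimple_eq_0_iff[OF S ss] by blast
    obtain C where C: "conjugacy_class C" and xC: "x \<in> C" by (rule conjugacy_class_ex)
    have CS: "C \<subseteq> nonzero_spectrum S" by (rule nonzero_spectrum_closed[OF S C xC x])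
    from semisimple_imp_spec[OF S ss] obtain P Q d
      where eb: "eigenbasis n P Q" and Sd: "map_mat to_ac S = eigenbasis.spec n P Q d" .
    interpret eigenbasis n P Q by fact
    \<comment> \<open>\<open>A\<close> is the part of \<open>S\<close> that belongs to \<open>C\<close>, and \<open>B\<close> is the part for all other classes.\<close>
    from class_component[OF eb S Sd C] obtain A where A: "A \<in> carrier_mat n n"
      and Ad: "map_mat to_ac A = spec (\<lambda>i. if d i \<in> C then d i else 0)" by blast
    define B where "B = S - A"
    have B: "B \<in> carrier_mat n n" using S A by (simp add: B_def minus_carrier_mat)
    have SAB: "S = A + B" using S A by (auto simp: B_def intro!: eq_matI)
    have "map_mat to_ac B = map_mat to_ac S - map_mat to_ac A"
      using S A by (auto simp: B_def intro!: eq_matI)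
    also have "\<dots> = spec (\<lambda>i. if d i \<in> C then 0 else d i)"
      unfolding Sd Ad spec_diff by (rule spec_cong) auto
    finally have Bd: "map_mat to_ac B = spec (\<lambda>i. if d i \<in> C then 0 else d i)" .
    have "map_mat to_ac (A * B) = map_mat to_ac (0\<^sub>m n n)"
      unfolding to_ac.mat_hom_mult[OF A B] Ad Bd spec_mult map_to_ac_0 spec_0[symmetric]
      by (rule spec_cong) auto
    then have AB: "A * B = 0\<^sub>m n n" by (rule to_ac.mat_hom_inj)
    have "map_mat to_ac (B * A) = map_mat to_ac (0\<^sub>m n n)"
      unfolding to_ac.mat_hom_mult[OF B A] Ad Bd spec_mult map_to_ac_0 spec_0[symmetric]
      by (rule spec_cong) auto
    then have BA: "B * A = 0\<^sub>m n n" by (rule to_ac.mat_hom_inj)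
    have spA: "nonzero_spectrum A = C"
      using CS unfolding nonzero_spectrum_spec[OF eb Sd] nonzero_spectrum_spec[OF eb Ad]
      by (auto split: if_splits)
    have "nonzero_spectrum A \<inter> nonzero_spectrum B = {}"
      unfolding spA nonzero_spectrum_spec[OF eb Bd] by auto
    then have "A = 0\<^sub>m n n \<or> B = 0\<^sub>m n n"
      using unb semisimple_if_spec[OF eb Ad] semisimple_if_spec[OF eb Bd] A B SAB AB BA S
      unfolding unbreakable_def Let_def by blast
    moreover have "A \<noteq> 0\<^sub>m n n"
      using spA xC semisimple_eq_0_iff[OF A semisimple_if_spec[OF eb Ad]] by auto
    ultimately have "S = A" using SAB A by simp
    then show ?thesis using spA C by simp
  qed simp
next
  assume alt: "S = 0\<^sub>m n n \<or> conjugacy_class (nonzero_spectrum S)"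
  show "unbreakable S"
    unfolding unbreakable_def Let_def
  proof (intro conjI ballI impI ss)
    fix A B :: "'a mat"
    assume "A \<in> carrier_mat (dim_row S) (dim_row S)" "B \<in> carrier_mat (dim_row S) (dim_row S)"
    then have A: "A \<in> carrier_mat n n" and B: "B \<in> carrier_mat n n" using S by auto
    assume H: "semisimple A \<and> semisimple B \<and> S = A + B \<and> A * B = 0\<^sub>m (dim_row S) (dim_row S) \<and>
      B * A = 0\<^sub>m (dim_row S) (dim_row S) \<and> nonzero_spectrum A \<inter> nonzero_spectrum B = {}"
    then have sum: "nonzero_spectrum S = nonzero_spectrum A \<union> nonzero_spectrum B"
      using nonzero_spectrum_add[OF A B] S by simp
    have "nonzero_spectrum A = {} \<or> nonzero_spectrum B = {}"
    proof (cases "S = 0\<^sub>m n n")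
      case True
      then show ?thesis using sum semisimple_eq_0_iff[OF S ss] by auto
    next
      case False
      with alt have C: "conjugacy_class (nonzero_spectrum S)" by simp
      show ?thesis
        using nonzero_spectrum_closed[OF A C] nonzero_spectrum_closed[OF B C] sum H by blast
    qed
    then show "A = 0\<^sub>m (dim_row S) (dim_row S) \<or> B = 0\<^sub>m (dim_row S) (dim_row S)"
      using semisimple_eq_0_iff[OF A] semisimple_eq_0_iff[OF B] H S by auto
  qed
qed

section \<open>Existence and uniqueness of decompositions\<close>

lemma finsum_mat_insert:
  fixes T :: "'i \<Rightarrow> 'a::comm_ring_1 mat"
  assumes "finite I" "i \<notin> I" "T \<in> insert i I \<rightarrow> carrier_mat n m"
  shows "finsum (module_mat TYPE('a) n m) T (insert i I) = T i + finsum (module_mat TYPE('a) n m) T I"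
proof -
  interpret abelian_group "module_mat TYPE('a) n m" by (rule abelian_group_mat)
  show ?thesis using assms by (subst finsum_insert) (auto simp: module_mat_simps)
qed

lemma finsum_mat_empty [simp]:
  "finsum (module_mat TYPE('a::comm_ring_1) n m) T {} = 0\<^sub>m n m"
proof -
  interpret abelian_group "module_mat TYPE('a) n m" by (rule abelian_group_mat)
  show ?thesis by (simp add: module_mat_simps)
qed

text \<open>
  A property that is additive and holds for all summands holds for the sum.  Instances are that
  a matrix is annihilated by a given matrix, or that it annihilates a given vector.
\<close>

lemma finsum_mat_induct:
  fixes T :: "'i \<Rightarrow> 'a::comm_ring_1 mat"
  assumes "finite I" "T \<in> I \<rightarrow> carrier_mat n m"
    and "R (0\<^sub>m n m)"
    and "\<And>i. i \<in> I \<Longrightarrow> R (T i)"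
    and add: "\<And>A B. A \<in> carrier_mat n m \<Longrightarrow> B \<in> carrier_mat n m \<Longrightarrow> R A \<Longrightarrow> R B \<Longrightarrow> R (A + B)"
  shows "finsum (module_mat TYPE('a) n m) T I \<in> carrier_mat n m \<and> R (finsum (module_mat TYPE('a) n m) T I)"
  using assms(1,2,4)
proof (induction I)
  case empty
  then show ?case using assms(3) by simp
next
  case (insert i I)
  then show ?case using add by (simp add: finsum_mat_insert Pi_iff)
qed

lemma finsum_spec:
  fixes T :: "'i \<Rightarrow> 'a::field mat"
  assumes eb: "eigenbasis n P Q" and I: "finite I" "T \<in> I \<rightarrow> carrier_mat n n"
    and g: "\<And>k. k \<in> I \<Longrightarrow> map_mat to_ac (T k) = eigenbasis.spec n P Q (g k)"
  shows "map_mat to_ac (finsum (module_mat TYPE('a) n n) T I) = eigenbasis.spec n P Q (\<lambda>i. \<Sum>k\<in>I. g k i)"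
  using I g
proof (induction I)
  interpret eigenbasis n P Q by fact
  case empty
  then show ?case by (simp add: spec_0)
next
  interpret eigenbasis n P Q by fact
  case (insert k I)
  have "finsum (module_mat TYPE('a) n n) T I \<in> carrier_mat n n"
    using finsum_mat_induct[of I T n n "\<lambda>_. True"] insert by auto
  then show ?case using insert by (simp add: finsum_mat_insert map_to_ac_add[of _ n n] spec_add)
qed

lemma decomposition_exists:
  fixes S :: "'a::field mat"
  assumes S: "S \<in> carrier_mat n n" and ss: "semisimple S"
    and classes: "consists_of_classes (nonzero_spectrum S) l"
  shows "\<exists>T. unbreakable_decomposition n S l T"
proof -
  from classes obtain \<C> where \<C>: "finite \<C>" "card \<C> = l" and class\<C>: "\<And>C. C \<in> \<C> \<Longrightarrow> conjugacy_class C"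
    and disj: "disjoint \<C>" and union: "\<Union>\<C> = nonzero_spectrum S"
    unfolding consists_of_classes_def by blast
  from \<C> obtain c where bij: "bij_betw c {..<l} \<C>"
    using ex_bij_betw_nat_finite[of \<C>] by (auto simp: atLeast0LessThan)
  then have c\<C>: "c k \<in> \<C>" if "k < l" for k using that by (auto simp: bij_betw_def)
  from semisimple_imp_spec[OF S ss] obtain P Q d
    where eb: "eigenbasis n P Q" and Sd: "map_mat to_ac S = eigenbasis.spec n P Q d" .
  interpret eigenbasis n P Q by fact
  define g where "g k i = (if d i \<in> c k then d i else 0)" for k i
  have "\<forall>k. \<exists>M. k < l \<longrightarrow> M \<in> carrier_mat n n \<and> map_mat to_ac M = spec (g k)"
    using class_component[OF eb S Sd class\<C>[OF c\<C>]] unfolding g_def by blast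
  then obtain T where T: "\<And>k. k < l \<Longrightarrow> T k \<in> carrier_mat n n"
    and Tg: "\<And>k. k < l \<Longrightarrow> map_mat to_ac (T k) = spec (g k)" by metis
  have ssT: "semisimple (T k)" if "k < l" for k
    using semisimple_if_spec[OF eb Tg[OF that]] .
  have spT: "nonzero_spectrum (T k) = c k" if "k < l" for k
    using union c\<C>[OF that]
    unfolding nonzero_spectrum_spec[OF eb Tg[OF that]] nonzero_spectrum_spec[OF eb Sd] g_def
    by (auto split: if_splits)
  have disjc: "c i \<inter> c j = {}" if "i < l" "j < l" "i \<noteq> j" for i j
    using disjointD[OF disj c\<C>[OF that(1)] c\<C>[OF that(2)]] bij that
    by (auto simp: bij_betw_def inj_on_def)
  have sum: "(\<Sum>k<l. g k i) = d i" if i: "i < n" for i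
  proof (cases "d i = 0")
    case True
    then show ?thesis by (auto simp: g_def intro: sum.neutral)
  next
    case False
    then have "d i \<in> \<Union>\<C>" using i unfolding union nonzero_spectrum_spec[OF eb Sd] by auto
    then obtain k where k: "k < l" "d i \<in> c k" using bij by (auto simp: bij_betw_def)
    have "(\<Sum>j<l. g j i) = (\<Sum>j<l. if j = k then d i else 0)"
      using k disjc by (intro sum.cong) (auto simp: g_def)
    then show ?thesis using k by simp
  qed
  have "map_mat to_ac (finsum (module_mat TYPE('a) n n) T {..<l}) = map_mat to_ac S"
    using finsum_spec[OF eb, of "{..<l}" T g] T Tg spec_cong[of _ d, OF sum] by (auto simp: Sd)
  then have "S = finsum (module_mat TYPE('a) n n) T {..<l}"
    by (metis to_ac.mat_hom_inj)
  moreover have "T i * T j = 0\<^sub>m n n" if "i < l" "j < l" "i \<noteq> j" for i j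
  proof -
    have "map_mat to_ac (T i * T j) = map_mat to_ac (0\<^sub>m n n)"
      unfolding to_ac.mat_hom_mult[OF T[OF that(1)] T[OF that(2)]] Tg[OF that(1)] Tg[OF that(2)]
        spec_mult map_to_ac_0 spec_0[symmetric]
      using disjc[OF that] by (intro spec_cong) (auto simp: g_def)
    then show ?thesis by (rule to_ac.mat_hom_inj)
  qed
  moreover have "T k \<noteq> 0\<^sub>m n n \<and> unbreakable (T k)" if "k < l" for k
    using unbreakable_iff[OF T[OF that] ssT[OF that]] semisimple_eq_0_iff[OF T[OF that] ssT[OF that]]
      spT[OF that] class\<C>[OF c\<C>[OF that]] conjugacy_class_nonempty by auto
  ultimately show ?thesis
    using T ssT spT disjc unfolding unbreakable_decomposition_def by (intro exI[of _ T]) auto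
qed

text \<open>
  For \<open>x \<noteq> 0\<close>, the vector \<open>A w\<close> would be an eigenvector if it did not vanish.  For \<open>x = 0\<close> the claim
  is that \<open>A\<^sup>2 w = 0\<close> implies \<open>A w = 0\<close>, which is where semisimplicity enters: inverting the nonzero
  eigenvalues yields a matrix \<open>R\<close> with \<open>R A\<^sup>2 = A\<close>.
\<close>

lemma semisimple_image_eigenvector:
  fixes A :: "'a::field mat"
  assumes A: "A \<in> carrier_mat n n" and ss: "semisimple A" and w: "w \<in> carrier_vec n"
    and eig: "map_mat to_ac A *\<^sub>v (map_mat to_ac A *\<^sub>v w) = x \<cdot>\<^sub>v (map_mat to_ac A *\<^sub>v w)"
    and x: "x \<notin> nonzero_spectrum A"
  shows "map_mat to_ac A *\<^sub>v w = 0\<^sub>v n"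
proof (cases "x = 0")
  case False
  let ?A = "map_mat to_ac A"
  have "?A *\<^sub>v w \<in> carrier_vec n" using A w by auto
  moreover have "?A \<in> carrier_mat n n" using A by simp
  ultimately show ?thesis
    using x False eig eigenvalue_iff_vec[of ?A n x] unfolding nonzero_spectrum_def by blast
next
  case True
  from semisimple_imp_spec[OF A ss] obtain P Q d
    where eb: "eigenbasis n P Q" and Ad: "map_mat to_ac A = eigenbasis.spec n P Q d" .
  interpret eigenbasis n P Q by fact
  \<comment> \<open>Since \<open>inverse 0 = 0\<close>, the identity holds at zero eigenvalues as well.\<close>
  have "spec (\<lambda>i. inverse (d i)) * (spec d * spec d) = spec d"
    unfolding spec_mult by (rule spec_cong) (simp add: field_simps)
  then have "spec d *\<^sub>v w = (spec (\<lambda>i. inverse (d i)) * (spec d * spec d)) *\<^sub>v w" by simp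
  also have "\<dots> = spec (\<lambda>i. inverse (d i)) *\<^sub>v (spec d *\<^sub>v (spec d *\<^sub>v w))"
    using w by (simp add: assoc_mult_mat_vec[of _ n n _ n])
  also have "spec d *\<^sub>v (spec d *\<^sub>v w) = 0\<^sub>v n"
    using eig w unfolding Ad True by (auto simp: carrier_matD[OF spec_carrier] intro!: eq_vecI)
  also have "spec (\<lambda>i. inverse (d i)) *\<^sub>v 0\<^sub>v n = 0\<^sub>v n"
    by (auto simp: carrier_matD[OF spec_carrier] intro!: eq_vecI)
  finally show ?thesis unfolding Ad .
qed

text \<open>
  One summand against the sum \<open>R\<close> of the others: this reduces statements about many summands to
  the case of two matrices with vanishing products.
\<close>

lemma decomposition_split:
  fixes S :: "'a::field mat"
  assumes dec: "unbreakable_decomposition n S l T" and i: "i < l"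
  obtains R where "R \<in> carrier_mat n n" "S = T i + R" "T i * R = 0\<^sub>m n n" "R * T i = 0\<^sub>m n n"
    "\<And>v. v \<in> carrier_vec n \<Longrightarrow> (\<And>j. j < l \<Longrightarrow> j \<noteq> i \<Longrightarrow> map_mat to_ac (T j) *\<^sub>v v = 0\<^sub>v n)
      \<Longrightarrow> map_mat to_ac R *\<^sub>v v = 0\<^sub>v n"
proof -
  from dec have T: "\<And>j. j < l \<Longrightarrow> T j \<in> carrier_mat n n"
    and prod: "\<And>j k. j < l \<Longrightarrow> k < l \<Longrightarrow> j \<noteq> k \<Longrightarrow> T j * T k = 0\<^sub>m n n"
    and Ssum: "S = finsum (module_mat TYPE('a) n n) T {..<l}"
    unfolding unbreakable_decomposition_def by auto
  let ?I = "{..<l} - {i}"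
  define R where "R = finsum (module_mat TYPE('a) n n) T ?I"
  have TI: "T \<in> ?I \<rightarrow> carrier_mat n n" using T by auto
  have R: "R \<in> carrier_mat n n"
    using finsum_mat_induct[of ?I T n n "\<lambda>_. True"] TI by (simp add: R_def)
  have "{..<l} = insert i ?I" using i by auto
  then have "S = T i + R"
    unfolding Ssum R_def using finsum_mat_insert[of ?I i T n n] T i by auto
  moreover have "T i * R = 0\<^sub>m n n \<and> R * T i = 0\<^sub>m n n"
    using finsum_mat_induct[of ?I T n n "\<lambda>M. T i * M = 0\<^sub>m n n \<and> M * T i = 0\<^sub>m n n"] TI prod i T[OF i]
    by (simp add: R_def mult_add_distrib_mat[of _ n n _ n] add_mult_distrib_mat[of _ n n _ _ n])
  moreover have "map_mat to_ac R *\<^sub>v v = 0\<^sub>v n" if v: "v \<in> carrier_vec n"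
    and 0: "\<And>j. j < l \<Longrightarrow> j \<noteq> i \<Longrightarrow> map_mat to_ac (T j) *\<^sub>v v = 0\<^sub>v n" for v
    using finsum_mat_induct[of ?I T n n "\<lambda>M. map_mat to_ac M *\<^sub>v v = 0\<^sub>v n"] TI v 0
    by (simp add: R_def map_to_ac_add[of _ n n] add_mult_distrib_mat_vec[of _ n n])
  ultimately show thesis using that R by blast
qed

text \<open>
  As the other summands annihilate \<open>T i\<close>, we have \<open>T i * T i = T i * S\<close>, so \<open>T i\<close> maps \<open>T i v\<close> to
  \<open>x T i v\<close>.  As \<open>x\<close> is not among its nonzero eigenvalues and \<open>T i\<close> is semisimple, \<open>T i v\<close> is 0.
\<close>

lemma decomposition_kills_eigenvector:
  fixes S :: "'a::field mat"
  assumes dec: "unbreakable_decomposition n S l T" and i: "i < l"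
    and v: "v \<in> carrier_vec n" and Sv: "map_mat to_ac S *\<^sub>v v = x \<cdot>\<^sub>v v"
    and x: "x \<notin> nonzero_spectrum (T i)"
  shows "map_mat to_ac (T i) *\<^sub>v v = 0\<^sub>v n"
proof (rule semisimple_image_eigenvector[OF _ _ v _ x])
  show T: "T i \<in> carrier_mat n n" and "semisimple (T i)"
    using dec i unfolding unbreakable_decomposition_def by auto
  from decomposition_split[OF dec i] obtain R where R: "R \<in> carrier_mat n n"
    and SR: "S = T i + R" and TR: "T i * R = 0\<^sub>m n n" by blast
  let ?T = "map_mat to_ac (T i)" and ?S = "map_mat to_ac S"
  have S: "S \<in> carrier_mat n n" using SR T R by simp
  have "T i * S = T i * T i"
    unfolding SR using T R TR by (simp add: mult_add_distrib_mat[of _ n n _ n] right_add_zero_mat[of _ n n])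
  then have TS: "?T * ?S = ?T * ?T"
    by (metis to_ac.mat_hom_mult T S)
  have "?T *\<^sub>v (?T *\<^sub>v v) = (?T * ?T) *\<^sub>v v"
    using T v by (simp add: assoc_mult_mat_vec[of _ n n _ n])
  also have "\<dots> = ?T *\<^sub>v (?S *\<^sub>v v)"
    unfolding TS[symmetric] using T S v by (simp add: assoc_mult_mat_vec[of _ n n _ n])
  also have "\<dots> = x \<cdot>\<^sub>v (?T *\<^sub>v v)"
    unfolding Sv using T v by (simp add: mult_mat_vec)
  finally show "?T *\<^sub>v (?T *\<^sub>v v) = x \<cdot>\<^sub>v (?T *\<^sub>v v)" .
qed

lemma decomposition_acts_on_eigenvector:
  fixes S :: "'a::field mat"
  assumes dec: "unbreakable_decomposition n S l T" and i: "i < l"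
    and v: "v \<in> carrier_vec n" and Sv: "map_mat to_ac S *\<^sub>v v = x \<cdot>\<^sub>v v"
    and x: "\<And>j. j < l \<Longrightarrow> j \<noteq> i \<Longrightarrow> x \<notin> nonzero_spectrum (T j)"
  shows "map_mat to_ac (T i) *\<^sub>v v = x \<cdot>\<^sub>v v"
proof -
  have T: "T i \<in> carrier_mat n n"
    using dec i unfolding unbreakable_decomposition_def by auto
  from decomposition_split[OF dec i] obtain R where R: "R \<in> carrier_mat n n" and SR: "S = T i + R"
    and ker: "\<And>v. v \<in> carrier_vec n \<Longrightarrow> (\<And>j. j < l \<Longrightarrow> j \<noteq> i \<Longrightarrow> map_mat to_ac (T j) *\<^sub>v v = 0\<^sub>v n)
      \<Longrightarrow> map_mat to_ac R *\<^sub>v v = 0\<^sub>v n" by metis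
  have "map_mat to_ac R *\<^sub>v v = 0\<^sub>v n"
    using ker[OF v] decomposition_kills_eigenvector[OF dec _ v Sv x] by blast
  then show ?thesis
    using Sv T R v unfolding SR map_to_ac_add[OF T R] by (simp add: add_mult_distrib_mat_vec[of _ n n])
qed

text \<open>
  The columns of \<open>P\<close> are eigenvectors of \<open>S\<close> and form a basis, and the action of \<open>T i\<close> on each
  of them is known.  The right-hand side depends on \<open>T i\<close> only through its nonzero spectrum.
\<close>

lemma decomposition_summand_spec:
  fixes S :: "'a::field mat"
  assumes dec: "unbreakable_decomposition n S l T" and i: "i < l"
    and eb: "eigenbasis n P Q" and Sd: "map_mat to_ac S = eigenbasis.spec n P Q d"
  shows "map_mat to_ac (T i) = eigenbasis.spec n P Q (\<lambda>k. if d k \<in> nonzero_spectrum (T i) then d k else 0)"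
proof -
  interpret eigenbasis n P Q by fact
  from dec have T: "T i \<in> carrier_mat n n"
    and disj: "\<And>j. j < l \<Longrightarrow> j \<noteq> i \<Longrightarrow> nonzero_spectrum (T i) \<inter> nonzero_spectrum (T j) = {}"
    using i unfolding unbreakable_decomposition_def by auto
  show ?thesis
  proof (rule eq_specI)
    show "map_mat to_ac (T i) \<in> carrier_mat n n" using T by simp
    fix k assume k: "k < n"
    have v: "col P k \<in> carrier_vec n" using k carrier_matD[OF P] by (simp add: carrier_vecI)
    have Sv: "map_mat to_ac S *\<^sub>v col P k = d k \<cdot>\<^sub>v col P k"
      unfolding Sd by (rule spec_mult_col[OF k])
    show "map_mat to_ac (T i) *\<^sub>v col P k = (if d k \<in> nonzero_spectrum (T i) then d k else 0) \<cdot>\<^sub>v col P k"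
    proof (cases "d k \<in> nonzero_spectrum (T i)")
      case True
      with decomposition_acts_on_eigenvector[OF dec i v Sv] disj show ?thesis by auto
    next
      case False
      moreover have "0 \<cdot>\<^sub>v col P k = 0\<^sub>v n" using k carrier_matD[OF P] by (intro eq_vecI) auto
      ultimately show ?thesis using decomposition_kills_eigenvector[OF dec i v Sv] by simp
    qed
  qed
qed

text \<open>
  An eigenvector of \<open>S\<close> for a nonzero \<open>x\<close> outside all the spectra would be killed by every
  summand, hence by \<open>S\<close>; this is why the spectra of the summands exhaust that of \<open>S\<close>.
\<close>

lemma decomposition_classes:
  fixes S :: "'a::field mat"
  assumes dec: "unbreakable_decomposition n S l T"
  shows "i < l \<Longrightarrow> conjugacy_class (nonzero_spectrum (T i))"
    and "(\<Union>i<l. nonzero_spectrum (T i)) = nonzero_spectrum S"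
    and "inj_on (\<lambda>i. nonzero_spectrum (T i)) {..<l}"
proof -
  have T: "T i \<in> carrier_mat n n" "T i \<noteq> 0\<^sub>m n n" "semisimple (T i)" "unbreakable (T i)" if "i < l" for i
    using dec that unfolding unbreakable_decomposition_def by auto
  show cls: "conjugacy_class (nonzero_spectrum (T i))" if "i < l" for i
    using unbreakable_iff[of "T i" n] T[OF that] by blast
  show "inj_on (\<lambda>i. nonzero_spectrum (T i)) {..<l}"
    using dec conjugacy_class_nonempty[OF cls]
    unfolding unbreakable_decomposition_def inj_on_def by (metis inf.idem lessThan_iff)
  have sub: "nonzero_spectrum (T i) \<subseteq> nonzero_spectrum S" if i: "i < l" for i
  proof -
    from decomposition_split[OF dec i] obtain R where "R \<in> carrier_mat n n" "S = T i + R"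
      "T i * R = 0\<^sub>m n n" "R * T i = 0\<^sub>m n n" by blast
    then show ?thesis using nonzero_spectrum_add[of "T i" n R] T(1)[OF i] by auto
  qed
  have S: "map_mat to_ac S \<in> carrier_mat n n"
    using dec T finsum_mat_induct[of "{..<l}" T n n "\<lambda>_. True"]
    unfolding unbreakable_decomposition_def by auto
  have "x \<in> (\<Union>i<l. nonzero_spectrum (T i))" if x: "x \<in> nonzero_spectrum S" for x
  proof (rule ccontr)
    assume out: "x \<notin> (\<Union>i<l. nonzero_spectrum (T i))"
    from x have x0: "x \<noteq> 0" and "eigenvalue (map_mat to_ac S) x"
      unfolding nonzero_spectrum_def by auto
    then obtain v where v: "v \<in> carrier_vec n" "v \<noteq> 0\<^sub>v n" and Sv: "map_mat to_ac S *\<^sub>v v = x \<cdot>\<^sub>v v"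
      unfolding eigenvalue_iff_vec[OF S] by blast
    have "map_mat to_ac (T i) *\<^sub>v v = 0\<^sub>v n" if "i < l" for i
      using decomposition_kills_eigenvector[OF dec that v(1) Sv] out that by auto
    then have "map_mat to_ac (finsum (module_mat TYPE('a) n n) T {..<l}) *\<^sub>v v = 0\<^sub>v n"
      using finsum_mat_induct[of "{..<l}" T n n "\<lambda>M. map_mat to_ac M *\<^sub>v v = 0\<^sub>v n"] T(1) v(1)
      by (simp add: Pi_iff map_to_ac_add[of _ n n] add_mult_distrib_mat_vec[of _ n n])
    then have "x \<cdot>\<^sub>v v = 0\<^sub>v n"
      using Sv dec unfolding unbreakable_decomposition_def by simp
    from smult_vec_eq_0D[OF this x0] v show False by simp
  qed
  with sub show "(\<Union>i<l. nonzero_spectrum (T i)) = nonzero_spectrum S" by blast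
qed

text \<open>
  An element \<open>x\<close> of the spectrum of \<open>T i\<close> lies in the spectrum of some \<open>U j\<close>; two classes with a
  common element are equal, and the class determines the summand.
\<close>

lemma decomposition_image_subset:
  fixes S :: "'a::field mat"
  assumes S: "S \<in> carrier_mat n n" and ss: "semisimple S"
    and T: "unbreakable_decomposition n S l T" and U: "unbreakable_decomposition n S m U"
  shows "T ` {..<l} \<subseteq> U ` {..<m}"
proof
  fix M assume "M \<in> T ` {..<l}"
  then obtain i where i: "i < l" and M: "M = T i" by auto
  note clsT = decomposition_classes[OF T] and clsU = decomposition_classes[OF U]
  obtain x where x: "x \<in> nonzero_spectrum (T i)"
    using conjugacy_class_nonempty[OF clsT(1)[OF i]] by blast
  with i have "x \<in> nonzero_spectrum S" unfolding clsT(2)[symmetric] by blast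
  then obtain j where j: "j < m" "x \<in> nonzero_spectrum (U j)" unfolding clsU(2)[symmetric] by blast
  have eq: "nonzero_spectrum (T i) = nonzero_spectrum (U j)"
    using conjugacy_class_unique[OF clsT(1)[OF i] clsU(1)[OF j(1)] x j(2)] .
  from semisimple_imp_spec[OF S ss] obtain P Q d
    where eb: "eigenbasis n P Q" and Sd: "map_mat to_ac S = eigenbasis.spec n P Q d" .
  have "map_mat to_ac (T i) = map_mat to_ac (U j)"
    unfolding decomposition_summand_spec[OF T i eb Sd] decomposition_summand_spec[OF U j(1) eb Sd] eq ..
  then have "T i = U j" by (rule to_ac.mat_hom_inj)
  then show "M \<in> U ` {..<m}" using j M by blast
qed

lemma inj_on_same_image_permutes:
  assumes T: "inj_on T {..<l::nat}" and U: "inj_on U {..<m::nat}" and im: "T ` {..<l} = U ` {..<m}"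
  shows "l = m \<and> (\<exists>\<pi>. \<pi> permutes {..<l} \<and> (\<forall>i<l. U i = T (\<pi> i)))"
proof -
  have "l = card (T ` {..<l})" using card_image[OF T] by simp
  also have "\<dots> = m" using im card_image[OF U] by simp
  finally have lm: "l = m" .
  define \<pi> where "\<pi> i = (if i < l then inv_into {..<l} T (U i) else i)" for i
  have "bij_betw U {..<l} (T ` {..<l})" using U im lm by (simp add: bij_betw_def)
  moreover have "bij_betw (inv_into {..<l} T) (T ` {..<l}) {..<l}"
    using T by (intro bij_betw_inv_into) (simp add: bij_betw_def)
  ultimately have "bij_betw (inv_into {..<l} T \<circ> U) {..<l} {..<l}" by (rule bij_betw_trans)
  then have "bij_betw \<pi> {..<l} {..<l}"
    by (subst bij_betw_cong[of _ _ "inv_into {..<l} T \<circ> U"]) (auto simp: \<pi>_def)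
  then have "\<pi> permutes {..<l}" by (rule bij_imp_permutes) (auto simp: \<pi>_def)
  moreover have "U i = T (\<pi> i)" if "i < l" for i
    using that im lm f_inv_into_f[of "U i" T "{..<l}"] by (auto simp: \<pi>_def)
  ultimately show ?thesis using lm by blast
qed

lemma decomposition_unique:
  fixes S :: "'a::field mat"
  assumes S: "S \<in> carrier_mat n n" and ss: "semisimple S"
    and T: "unbreakable_decomposition n S l T" and U: "unbreakable_decomposition n S m U"
  shows "l = m \<and> (\<exists>\<pi>. \<pi> permutes {..<l} \<and> (\<forall>i<l. U i = T (\<pi> i)))"
proof (rule inj_on_same_image_permutes)
  show "T ` {..<l} = U ` {..<m}"
    using decomposition_image_subset[OF S ss T U] decomposition_image_subset[OF S ss U T] by blast
  show "inj_on T {..<l}" "inj_on U {..<m}"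
    using decomposition_classes(3)[OF T] decomposition_classes(3)[OF U]
    by (auto simp: inj_on_def)
qed

theorem proposition2p3:
  fixes S :: "'a::field mat" and n :: nat
  assumes "S \<in> carrier_mat n n"
    and "semisimple S"
  shows "((unbreakable S \<longleftrightarrow> S = 0\<^sub>m n n \<or> conjugacy_class (nonzero_spectrum S)) \<and>
         (S = 0\<^sub>m n n \<longleftrightarrow> nonzero_spectrum S = {})) \<and>
         (\<forall>l\<ge>1. consists_of_classes (nonzero_spectrum S) l \<longrightarrow>
           (\<exists>T. unbreakable_decomposition n S l T)) \<and>
         (S \<noteq> 0\<^sub>m n n \<longrightarrow>
           (\<forall>l m T U. unbreakable_decomposition n S l T \<and> unbreakable_decomposition n S m U \<longrightarrow>
              l = m \<and> (\<exists>\<pi>. \<pi> permutes {..<l} \<and> (\<forall>i<l. U i = T (\<pi> i)))))"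
  using unbreakable_iff[OF assms] semisimple_eq_0_iff[OF assms] decomposition_exists[OF assms]
    decomposition_unique[OF assms] by blast

end
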